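(* Let $k$ be a positive integer and $n\ge 0$ an integer. The binomial transform of the higher order Mersenne sequence is given explicitly by $$b_{k,n}=\frac{m_k^{\,n}-2^n}{2^k-1} .$$
   Context: The Mersenne numbers $\{M_n\}_{n\ge 0}$ are defined by $M_0=0$, $M_1=1$, $M_{n+2}=3M_{n+1}-2M_n$, i.e. $M_n=2^n-1$. The Mersenne-Lucas numbers satisfy the same recurrence with $m_0=2$, $m_1=3$, i.e. $m_n=2^n+1$. For a positive integer $k$, the higher order Mersenne numbers are $M_n^{(k)}=M_{kn}/M_k$ for $n=0,1,2,\dots$, and their binomial transform is $b_{k,n}=\sum_{i=0}^{n}\binom{n}{i}M_i^{(k)}$ for $n\ge 0$. $m_k^{\,n}$ denotes the $n$th power of $m_k$. *)

theory Defs
  imports Complex_Main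
begin

fun mersenne :: "nat \<Rightarrow> int" where
  "mersenne 0 = 0"
| "mersenne (Suc 0) = 1"
| "mersenne (Suc (Suc n)) = 3 * mersenne (Suc n) - 2 * mersenne n"

fun mersenne_lucas :: "nat \<Rightarrow> int" where
  "mersenne_lucas 0 = 2"
| "mersenne_lucas (Suc 0) = 3"
| "mersenne_lucas (Suc (Suc n)) = 3 * mersenne_lucas (Suc n) - 2 * mersenne_lucas n"

(* The quotient is taken in the rationals, so it is exact without first knowing
   that mersenne k divides mersenne (k * n).  It is meaningful for k > 0 only. *)
definition higher_mersenne :: "nat \<Rightarrow> nat \<Rightarrow> rat" where
  "higher_mersenne k n = of_int (mersenne (k * n)) / of_int (mersenne k)"

definition binomial_transform :: "(nat \<Rightarrow> rat) \<Rightarrow> nat \<Rightarrow> rat" where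
  "binomial_transform a n = (\<Sum>i=0..n. of_nat (n choose i) * a i)"

end

theory Submission
  imports Defs
begin

text \<open>By \<open>mersenne_eq\<close>, the i-th term of the transform is a binomial coefficient
  times ((2^k)^i - 1) / (2^k - 1). Over this common denominator the sum splits into two binomial
  expansions, of (2^k + 1)^n and of (1 + 1)^n; \<open>mersenne_lucas_eq\<close> identifies the base
  2^k + 1.\<close>

lemma mersenne_eq: "mersenne n = 2 ^ n - 1"
  by (induction n rule: mersenne.induct) simp_all

lemma mersenne_lucas_eq: "mersenne_lucas n = 2 ^ n + 1"
  by (induction n rule: mersenne_lucas.induct) simp_all

theorem theorem2p23:
  fixes k n :: nat
  assumes "k > 0"
  shows "binomial_transform (higher_mersenne k) n
         = (of_int (mersenne_lucas k) ^ n - 2 ^ n) / (2 ^ k - 1)"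
proof -
  have "binomial_transform (higher_mersenne k) n
      = (\<Sum>i\<le>n. (of_nat (n choose i) * (2 ^ k) ^ i - of_nat (n choose i)) / (2 ^ k - 1))"
    unfolding binomial_transform_def higher_mersenne_def mersenne_eq atLeast0AtMost
    \<comment> \<open>Rewriting 2^(k i) as (2^k)^i exposes an i-th power for the binomial
      theorem.\<close>
    by (intro sum.cong refl) (simp add: power_mult [symmetric] algebra_simps)
  also have "\<dots> = ((\<Sum>i\<le>n. of_nat (n choose i) * (2 ^ k) ^ i)
      - (\<Sum>i\<le>n. of_nat (n choose i))) / (2 ^ k - 1)"
    by (simp only: sum_divide_distrib [symmetric] sum_subtractf)
  \<comment> \<open>Binomial theorem with summands 2^k and 1.\<close>
  also have "(\<Sum>i\<le>n. of_nat (n choose i) * (2 ^ k) ^ i) = ((2 ^ k + 1) ^ n :: rat)"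
    by (simp add: binomial_ring)
  also have "(\<Sum>i\<le>n. of_nat (n choose i)) = (2 ^ n :: rat)"
    \<comment> \<open>\<open>choose_row_sum\<close> is about naturals, so the cast is first pulled
      out of the sum.\<close>
    by (simp only: of_nat_sum [symmetric] choose_row_sum of_nat_power of_nat_numeral)
  finally show ?thesis
    by (simp add: mersenne_lucas_eq)
qed

end
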